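(* For the $d$-dimensional hypercube $Q_d$ ($d\ge 1$) and an integer $\ell$ with $0\le \ell\le 2^d$, $$Z^+_{(\ell)}(Q_d) = \begin{cases} 2^{d-1} & \text{if } \ell\le d-1,\\ 2^d & \text{if } d\le \ell\le 2^d.\end{cases}$$
   Context: $Q_d$ is the graph with vertex set $\{0,1\}^d$ in which two vertices are adjacent if and only if they differ in exactly one coordinate. All graphs are finite, simple and undirected. Positive semidefinite (psd) color change rule: given the current set $B$ of blue vertices of a graph $G$, let $W_1,\dots,W_k$ be the vertex sets of the connected components of $G-B$. If $u\in B$ and $w\in W_i$ is the only non-blue neighbor of $u$ in the induced subgraph $G[W_i\cup B]$, then $u$ may force $w$ (written $u\to w$), and $w$ becomes blue. The rule is applied iteratively, with the components recomputed from the current blue set. A leak is a vertex that is not allowed to perform any force. For $0\le \ell\le |V(G)|$, a set $B\subseteq V(G)$ is an $\ell$-leaky positive semidefinite forcing set of $G$ if, for every choice of $\ell$ vertices as leaks (chosen after $B$ is fixed; leaks may be inside or outside $B$), starting with exactly $B$ blue, iterated application of the psd color change rule, with forces performed only by non-leak vertices, colors all of $V(G)$ blue. The $\ell$-leaky positive semidefinite forcing number $Z^+_{(\ell)}(G)$ is the minimum cardinality of an $\ell$-leaky positive semidefinite forcing set of $G$. *)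

theory Defs
  imports "Graph_Theory.Graph_Theory"
begin

text \<open>
  Finite simple undirected graphs are represented as in the Graph_Theory library: symmetric,
  loop-free digraphs without parallel arcs (locales \<open>graph\<close> and \<open>pair_graph\<close>).
\<close>

section \<open>The hypercube\<close>

text \<open>The vertex set \<open>{0,1}^d\<close> is rendered as the boolean lists of length \<open>d\<close>.\<close>

definition hypercube :: "nat \<Rightarrow> bool list pair_pre_digraph" where
  "hypercube d =
    \<lparr> pverts = {x. length x = d},
      parcs = {(x, y). length x = d \<and> length y = d \<and> card {i. i < d \<and> x ! i \<noteq> y ! i} = 1} \<rparr>"

lemma card_pverts_hypercube: "card (pverts (hypercube d)) = 2 ^ d"
  using card_lists_length_eq[of "UNIV :: bool set" d] by (simp add: hypercube_def)

lemma finite_pverts_hypercube: "finite (pverts (hypercube d))"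
  using finite_lists_length_eq[of "UNIV :: bool set" d] by (simp add: hypercube_def)

lemma pair_graph_hypercube: "pair_graph (hypercube d)"
proof -
  have fin: "finite (parcs (hypercube d))"
    by (rule finite_subset[of _ "pverts (hypercube d) \<times> pverts (hypercube d)"])
       (auto simp: finite_pverts_hypercube, auto simp: hypercube_def)
  have "{i. i < d \<and> x ! i \<noteq> y ! i} = {i. i < d \<and> y ! i \<noteq> x ! i}" for x y :: "bool list"
    by blast
  then have sym: "symmetric (with_proj (hypercube d))"
    unfolding symmetric_def with_proj_simps by (intro symI) (simp add: hypercube_def)
  show ?thesis
  proof
    fix e assume "e \<in> parcs (hypercube d)"
    then show "fst e \<in> pverts (hypercube d)" "snd e \<in> pverts (hypercube d)" "fst e \<noteq> snd e"
      by (cases e, simp add: hypercube_def, cases e, simp add: hypercube_def,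
          cases e, clarsimp simp: hypercube_def)
  qed (fact finite_pverts_hypercube fin sym)+
qed


section \<open>Positive semidefinite forcing with leaks\<close>

text \<open>
  In a symmetric digraph, the strong components are the connected components
  of the undirected graph; see \<open>component_vsets_conv\<close> below.
\<close>

definition component_vsets :: "('a, 'b) pre_digraph \<Rightarrow> 'a set set" where
  "component_vsets G = pre_digraph.sccs_verts G"

lemma (in sym_digraph) component_vsets_conv:
  "component_vsets G = {{v. u \<rightarrow>\<^sup>* v} | u. u \<in> verts G}"
proof (intro set_eqI iffI)
  fix S assume "S \<in> component_vsets G"
  then have ne: "S \<noteq> {}" and conn: "\<And>u v. u \<in> S \<Longrightarrow> v \<in> S \<Longrightarrow> u \<rightarrow>\<^sup>* v"
    and max: "\<And>u v. u \<in> S \<Longrightarrow> v \<notin> S \<Longrightarrow> \<not> u \<rightarrow>\<^sup>* v \<or> \<not> v \<rightarrow>\<^sup>* u"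
    unfolding component_vsets_def sccs_verts_def by blast+
  obtain u where u: "u \<in> S" using ne by blast
  have "S = {v. u \<rightarrow>\<^sup>* v}"
    using conn[OF u] max[OF u] symmetric_reachable' by blast
  moreover have "u \<in> verts G"
    using conn[OF u u] by (rule reachable_in_verts(1))
  ultimately show "S \<in> {{v. u \<rightarrow>\<^sup>* v} | u. u \<in> verts G}" by blast
next
  fix S assume "S \<in> {{v. u \<rightarrow>\<^sup>* v} | u. u \<in> verts G}"
  then obtain u where S: "S = {v. u \<rightarrow>\<^sup>* v}" and u: "u \<in> verts G" by blast
  have "u \<in> S" using S u by simp
  moreover have "v \<rightarrow>\<^sup>* w" if "v \<in> S" "w \<in> S" for v w
    using that reachable_trans[OF symmetric_reachable'] unfolding S by blast
  moreover have "\<not> v \<rightarrow>\<^sup>* w" if "v \<in> S" "w \<notin> S" for v w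
    using that reachable_trans unfolding S by blast
  ultimately show "S \<in> component_vsets G"
    unfolding component_vsets_def sccs_verts_def by blast
qed

definition psd_can_force :: "('a, 'b) pre_digraph \<Rightarrow> 'a set \<Rightarrow> 'a \<Rightarrow> 'a \<Rightarrow> bool" where
  "psd_can_force G B u w \<longleftrightarrow>
    u \<in> B \<and>
    (\<exists>W \<in> component_vsets (G \<restriction> (verts G - B)).
       w \<in> W \<and> {v \<in> verts (G \<restriction> (W \<union> B)) - B. u \<rightarrow>\<^bsub>G \<restriction> (W \<union> B)\<^esub> v} = {w})"

definition psd_step :: "('a, 'b) pre_digraph \<Rightarrow> 'a set \<Rightarrow> 'a set \<Rightarrow> 'a set \<Rightarrow> bool" where
  "psd_step G L B B' \<longleftrightarrow> (\<exists>u w. u \<notin> L \<and> psd_can_force G B u w \<and> B' = insert w B)"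

text \<open>
  Forces are performed one at a time, with the components recomputed after each. A possible force
  stays possible as the blue set grows (until its target is blue), so the final colouring does not
  depend on the order, and reachability of the all-blue colouring is the right condition.
\<close>

definition leaky_psd_forcing_set :: "nat \<Rightarrow> ('a, 'b) pre_digraph \<Rightarrow> 'a set \<Rightarrow> bool" where
  "leaky_psd_forcing_set l G B \<longleftrightarrow>
    B \<subseteq> verts G \<and> (\<forall>L \<subseteq> verts G. card L = l \<longrightarrow> (psd_step G L)\<^sup>*\<^sup>* B (verts G))"

definition leaky_psd_forcing_number :: "nat \<Rightarrow> ('a, 'b) pre_digraph \<Rightarrow> nat" where
  "leaky_psd_forcing_number l G = (LEAST k. \<exists>B. leaky_psd_forcing_set l G B \<and> card B = k)"

lemma leaky_psd_forcing_set_verts: "leaky_psd_forcing_set l G (verts G)"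
  by (simp add: leaky_psd_forcing_set_def)

end

theory Submission
  imports Defs Complex_Main
begin

text \<open>
  If \<open>l < d\<close>, the vertices of even weight form an \<open>l\<close>-leaky set: every odd vertex is a component
  of its own and has \<open>d\<close> blue neighbours, one of which is not a leak. If \<open>l \<ge> d\<close>, then putting
  leaks on all neighbours of a white vertex protects it for ever, so only the whole vertex set
  works.

  The lower bound \<open>2 ^ (d - 1)\<close> comes from the kernel of a positive semidefinite matrix. The
  signed adjacency matrix \<open>H\<close> of the hypercube satisfies \<open>H\<^sup>2 = d\<close>, so \<open>A = H + sqrt d\<close> satisfies
  \<open>A\<^sup>2 = 2 * sqrt d * A\<close> and is positive semidefinite with a kernel of dimension \<open>2 ^ (d - 1)\<close>.
  A kernel vector \<open>f\<close> that vanishes on the blue set \<open>B\<close> also vanishes on every vertex \<open>w\<close> forced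
  by some \<open>u\<close> via a component \<open>W\<close>: the restriction \<open>g\<close> of \<open>f\<close> to \<open>W\<close> satisfies
  \<open>\<langle>g, A g\<rangle> = 0\<close>, hence \<open>A g = 0\<close>, and the entry of \<open>A g\<close> at \<open>u\<close> is \<open>\<plusminus>f w\<close>. So no nonzero
  kernel vector vanishes on a forcing set, whose size is therefore at least the dimension of
  the kernel.
\<close>

section \<open>Forcing in symmetric digraphs\<close>

lemma dominates_induce_subgraph_iff:
  "u \<rightarrow>\<^bsub>G \<restriction> S\<^esub> v \<longleftrightarrow> u \<rightarrow>\<^bsub>G\<^esub> v \<and> u \<in> S \<and> v \<in> S"
  by (auto simp: arcs_ends_conv)

context sym_digraph
begin

lemma sym_digraph_induce_subgraph: "sym_digraph (G \<restriction> S)"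
proof -
  interpret S: wf_digraph "G \<restriction> S" by auto
  show ?thesis
    using sym_arcs by unfold_locales (auto simp: symmetric_def sym_def dominates_induce_subgraph_iff)
qed

text \<open>Replaces the reachability description of a component by local closure: a white neighbour
  of a member of \<open>W\<close> lies in \<open>W\<close>. This is what allows a vector to be cut
  down to \<open>W\<close> in the lower bound.\<close>

lemma psd_can_forceE:
  assumes "psd_can_force G B u w"
  obtains W where "u \<in> B" "W \<subseteq> verts G - B" "w \<in> W" "u \<rightarrow> w"
    "\<And>v. v \<in> W \<Longrightarrow> u \<rightarrow> v \<Longrightarrow> v = w"
    "\<And>x y. x \<in> W \<Longrightarrow> x \<rightarrow> y \<Longrightarrow> y \<notin> B \<Longrightarrow> y \<in> W"
proof -
  let ?H = "G \<restriction> (verts G - B)"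
  interpret H: sym_digraph ?H by (rule sym_digraph_induce_subgraph)
  obtain W where u: "u \<in> B" and W: "W \<in> component_vsets ?H" and w: "w \<in> W"
    and only: "{v \<in> verts (G \<restriction> (W \<union> B)) - B. u \<rightarrow>\<^bsub>G \<restriction> (W \<union> B)\<^esub> v} = {w}"
    using assms unfolding psd_can_force_def by blast
  obtain z where Wz: "W = {v. z \<rightarrow>\<^sup>*\<^bsub>?H\<^esub> v}"
    using W unfolding H.component_vsets_conv by blast
  have sub: "W \<subseteq> verts G - B"
    unfolding Wz using H.reachable_in_verts(2) by auto
  have only': "v = w" if "v \<in> W" "u \<rightarrow> v" for v
  proof -
    have "v \<in> {v \<in> verts (G \<restriction> (W \<union> B)) - B. u \<rightarrow>\<^bsub>G \<restriction> (W \<union> B)\<^esub> v}"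
      using that u sub by (auto simp: dominates_induce_subgraph_iff)
    then show ?thesis unfolding only by simp
  qed
  have "u \<rightarrow> w"
    using only by (auto simp: dominates_induce_subgraph_iff)
  moreover have "y \<in> W" if "x \<in> W" "x \<rightarrow> y" "y \<notin> B" for x y
  proof -
    have "x \<rightarrow>\<^bsub>?H\<^esub> y"
      using that sub adj_in_verts(2) by (auto simp: dominates_induce_subgraph_iff)
    then show ?thesis
      using that(1) unfolding Wz by (auto intro: H.reachable_adj_trans)
  qed
  ultimately show thesis using that u sub w only' by blast
qed

lemma psd_can_force_dominates: "psd_can_force G B u w \<Longrightarrow> u \<rightarrow> w"
  by (erule psd_can_forceE)

lemma psd_can_force_isolated:
  assumes "u \<in> B" "u \<rightarrow> w" "w \<notin> B" and iso: "\<And>v. w \<rightarrow> v \<Longrightarrow> v \<in> B"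
  shows "psd_can_force G B u w"
proof -
  let ?H = "G \<restriction> (verts G - B)"
  interpret H: sym_digraph ?H by (rule sym_digraph_induce_subgraph)
  have w: "w \<in> verts ?H" using assms adj_in_verts(2) by auto
  have "v = w" if "w \<rightarrow>\<^sup>*\<^bsub>?H\<^esub> v" for v
    using that iso
    by (induct rule: H.reachable_induct) (auto simp: dominates_induce_subgraph_iff)
  then have "{w} = {v. w \<rightarrow>\<^sup>*\<^bsub>?H\<^esub> v}" using w by auto
  then have "{w} \<in> component_vsets ?H"
    unfolding H.component_vsets_conv using w by blast
  moreover have "{v \<in> verts (G \<restriction> ({w} \<union> B)) - B. u \<rightarrow>\<^bsub>G \<restriction> ({w} \<union> B)\<^esub> v} = {w}"
    using assms by (auto simp: dominates_induce_subgraph_iff)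
  ultimately show ?thesis
    using assms(1) unfolding psd_can_force_def by blast
qed

text \<open>Every white vertex has only blue neighbours, and keeps them as the blue set grows. It is
  thus a component of its own, and a non-leak neighbour can force it at any time.\<close>

lemma psd_step_star_independent_complement:
  assumes "finite (verts G)" "B \<subseteq> verts G"
    and indep: "\<And>w v. w \<in> verts G - B \<Longrightarrow> w \<rightarrow> v \<Longrightarrow> v \<in> B"
    and nbr: "\<And>w. w \<in> verts G - B \<Longrightarrow> \<exists>u. u \<notin> L \<and> w \<rightarrow> u"
  shows "(psd_step G L)\<^sup>*\<^sup>* B (verts G)"
proof -
  have "(psd_step G L)\<^sup>*\<^sup>* C (verts G)" if "B \<subseteq> C" "C \<subseteq> verts G" for C
    using that
  proof (induction "card (verts G - C)" arbitrary: C rule: less_induct)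
    case less
    show ?case
    proof (cases "C = verts G")
      case False
      then obtain w where w: "w \<in> verts G - C" using less.prems by blast
      then obtain u where u: "u \<notin> L" "w \<rightarrow> u" using nbr less.prems(1) by blast
      have "psd_can_force G C u w"
        using w u less.prems(1) indep graph_symmetric by (intro psd_can_force_isolated) blast+
      then have "psd_step G L C (insert w C)" using u(1) unfolding psd_step_def by blast
      moreover have "card (verts G - insert w C) < card (verts G - C)"
        using w assms(1) by (intro psubset_card_mono) auto
      then have "(psd_step G L)\<^sup>*\<^sup>* (insert w C) (verts G)"
        using less.prems w by (intro less.hyps) auto
      ultimately show ?thesis by (rule converse_rtranclp_into_rtranclp)
    qed simp
  qed
  then show ?thesis using assms(2) by blast
qed

lemma psd_step_star_avoids:
  assumes "(psd_step G L)\<^sup>*\<^sup>* B C" "v \<notin> B" "\<And>u. u \<rightarrow> v \<Longrightarrow> u \<in> L"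
  shows "v \<notin> C"
  using assms(1)
proof induction
  case (step C D)
  then show ?case
    using assms(3) unfolding psd_step_def by (auto dest: psd_can_force_dominates)
qed (fact assms(2))

end

lemma leaky_psd_forcing_number_eqI:
  assumes "leaky_psd_forcing_set l G B" "card B = k"
    and "\<And>C. leaky_psd_forcing_set l G C \<Longrightarrow> k \<le> card C"
  shows "leaky_psd_forcing_number l G = k"
  unfolding leaky_psd_forcing_number_def using assms by (intro Least_equality) auto


section \<open>Neighbourhoods in the hypercube\<close>

definition flip :: "nat \<Rightarrow> bool list \<Rightarrow> bool list" where
  "flip i x = x[i := \<not> x ! i]"

lemma length_flip [simp]: "length (flip i x) = length x"
  by (simp add: flip_def)

lemma flip_Cons_0 [simp]: "flip 0 (b # xs) = (\<not> b) # xs"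
  and flip_Cons_Suc [simp]: "flip (Suc i) (b # xs) = b # flip i xs"
  by (simp_all add: flip_def)

lemma pverts_hypercube [simp]: "pverts (hypercube d) = {x. length x = d}"
  by (simp add: hypercube_def)

lemma sym_digraph_hypercube: "sym_digraph (with_proj (hypercube d))"
proof -
  interpret pair_graph "hypercube d" by (rule pair_graph_hypercube)
  show ?thesis by unfold_locales
qed

lemma parcs_hypercube_iff:
  "(x, y) \<in> parcs (hypercube d) \<longleftrightarrow> length x = d \<and> (\<exists>i<d. y = flip i x)"
proof
  assume "(x, y) \<in> parcs (hypercube d)"
  then have len: "length x = d" "length y = d" and "card {i. i < d \<and> x ! i \<noteq> y ! i} = 1"
    by (auto simp: hypercube_def)
  then obtain i where i: "{i. i < d \<and> x ! i \<noteq> y ! i} = {i}"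
    by (auto simp: card_1_singleton_iff)
  then have "i < d" "x ! i \<noteq> y ! i" and "\<And>j. j < d \<Longrightarrow> j \<noteq> i \<Longrightarrow> x ! j = y ! j" by blast+
  then have "y = flip i x"
    using len by (intro nth_equalityI) (auto simp: flip_def nth_list_update)
  then show "length x = d \<and> (\<exists>i<d. y = flip i x)" using len \<open>i < d\<close> by blast
next
  assume "length x = d \<and> (\<exists>i<d. y = flip i x)"
  then obtain i where "length x = d" "i < d" "y = flip i x" by blast
  moreover from this have "{j. j < d \<and> x ! j \<noteq> y ! j} = {i}"
    by (auto simp: flip_def nth_list_update)
  ultimately show "(x, y) \<in> parcs (hypercube d)" by (simp add: hypercube_def)
qed

lemma inj_on_flip: "inj_on (\<lambda>i. flip i x) {..<length x}"
proof (rule inj_onI)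
  fix i j assume "i \<in> {..<length x}" "j \<in> {..<length x}" "flip i x = flip j x"
  then have "flip i x ! i = flip j x ! i" "i < length x" "j < length x" by simp_all
  then show "i = j" by (auto simp: flip_def nth_list_update split: if_splits)
qed

lemma even_count_flip:
  "i < length x \<Longrightarrow> even (count_list (flip i x) True) \<longleftrightarrow> odd (count_list x True)"
proof (induction x arbitrary: i)
  case (Cons b x)
  then show ?case by (cases i) auto
qed simp

section \<open>The even-weight set, and the case of many leaks\<close>

lemma card_even_lists:
  "card {x. length x = Suc n \<and> even (count_list x True)} = 2 ^ n"
proof -
  \<comment> \<open>The leading bit records the parity of the rest, so it is the unique one that
    makes the whole list even.\<close>
  let ?f = "\<lambda>xs. odd (count_list xs True) # xs"
  have "{x. length x = Suc n \<and> even (count_list x True)} = ?f ` {xs. length xs = n}"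
  proof (intro subset_antisym subsetI)
    fix x assume "x \<in> {x. length x = Suc n \<and> even (count_list x True)}"
    then show "x \<in> ?f ` {xs. length xs = n}"
      by (cases x) (auto split: if_splits)
  qed auto
  moreover have "inj_on ?f {xs. length xs = n}" by (auto intro: inj_onI)
  ultimately show ?thesis
    using card_pverts_hypercube[of n] by (simp add: card_image)
qed

lemma leaky_psd_forcing_set_even:
  assumes "l < d"
  shows "leaky_psd_forcing_set l (with_proj (hypercube d))
    {x. length x = d \<and> even (count_list x True)}"
proof -
  interpret sym_digraph "with_proj (hypercube d)" by (rule sym_digraph_hypercube)
  have "(psd_step (with_proj (hypercube d)) L)\<^sup>*\<^sup>*
      {x. length x = d \<and> even (count_list x True)} (verts (with_proj (hypercube d)))"
    if L: "L \<subseteq> verts (with_proj (hypercube d))" "card L = l" for L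
  proof (rule psd_step_star_independent_complement)
    fix w assume "w \<in> verts (with_proj (hypercube d)) - {x. length x = d \<and> even (count_list x True)}"
    then have w: "length w = d" by simp
    have "\<not> (\<lambda>i. flip i w) ` {..<d} \<subseteq> L"
    proof
      assume sub: "(\<lambda>i. flip i w) ` {..<d} \<subseteq> L"
      have "finite L" using L(1) finite_pverts_hypercube[of d] finite_subset by auto
      then have "card ((\<lambda>i. flip i w) ` {..<d}) \<le> l" using sub L(2) card_mono by blast
      then show False using assms inj_on_flip[of w] w by (simp add: card_image)
    qed
    then show "\<exists>u. u \<notin> L \<and> w \<rightarrow>\<^bsub>with_proj (hypercube d)\<^esub> u"
      using w by (auto simp: parcs_hypercube_iff)
  qed (auto simp: finite_pverts_hypercube[simplified] parcs_hypercube_iff even_count_flip)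
  then show ?thesis unfolding leaky_psd_forcing_set_def by auto
qed

lemma leaky_psd_forcing_set_many_leaks:
  assumes "d \<le> l" "l \<le> 2 ^ d" and B: "leaky_psd_forcing_set l (with_proj (hypercube d)) B"
  shows "B = {x. length x = d}"
proof (rule ccontr)
  interpret sym_digraph "with_proj (hypercube d)" by (rule sym_digraph_hypercube)
  assume "B \<noteq> {x. length x = d}"
  then obtain v where v: "length v = d" "v \<notin> B"
    using B unfolding leaky_psd_forcing_set_def by auto
  let ?N = "(\<lambda>i. flip i v) ` {..<d}"
  have "card ?N \<le> l" using card_image_le[of "{..<d}" "\<lambda>i. flip i v"] assms(1) by simp
  moreover have "?N \<subseteq> pverts (hypercube d)" using v(1) by auto
  \<comment> \<open>The at most \<open>d\<close> neighbours of \<open>v\<close> are padded to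
    exactly \<open>l\<close> leaks; there is room because \<open>l\<close> is at most
    \<open>2 ^ d\<close>.\<close>
  ultimately obtain L where L: "?N \<subseteq> L" "L \<subseteq> pverts (hypercube d)" "card L = l"
    using exists_subset_between[of ?N l "pverts (hypercube d)"] assms(2)
      card_pverts_hypercube[of d] finite_pverts_hypercube[of d] by metis
  have nbr: "u \<in> L" if "u \<rightarrow>\<^bsub>with_proj (hypercube d)\<^esub> v" for u
    using graph_symmetric[OF that] L(1) by (auto simp: parcs_hypercube_iff)
  have "(psd_step (with_proj (hypercube d)) L)\<^sup>*\<^sup>* B (verts (with_proj (hypercube d)))"
    using B L(2,3) unfolding leaky_psd_forcing_set_def by simp
  from psd_step_star_avoids[OF this v(2) nbr] show False using v(1) by simp
qed


section \<open>The signed adjacency operator\<close>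

definition bsign :: "bool \<Rightarrow> real" where
  "bsign b = (if b then - 1 else 1)"

text \<open>Huang's signing of the hypercube. The sign in direction \<open>i\<close> ignores
  coordinate \<open>i\<close>, so both ends of an edge agree on it, and every 4-cycle has an odd
  number of negative edges.\<close>

definition signed_adj :: "(bool list \<Rightarrow> real) \<Rightarrow> bool list \<Rightarrow> real" where
  "signed_adj f x = (\<Sum>i<length x. prod_list (map bsign (take i x)) * f (flip i x))"

lemma signed_adj_Nil [simp]: "signed_adj f [] = 0"
  by (simp add: signed_adj_def)

text \<open>Block recursion: with the \<open>False\<close> facet first, the matrix is [[H, I],
  [I, -H]], where H is the matrix one dimension lower.\<close>

lemma signed_adj_Cons:
  "signed_adj f (b # xs) = f ((\<not> b) # xs) + bsign b * signed_adj (\<lambda>ys. f (b # ys)) xs"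
  unfolding signed_adj_def length_Cons sum.lessThan_Suc_shift
  by (simp add: sum_distrib_left mult.assoc)

lemma signed_adj_lincomb:
  "signed_adj (\<lambda>x. a * f x + b * g x) x = a * signed_adj f x + b * signed_adj g x"
  by (simp add: signed_adj_def sum.distrib sum_distrib_left algebra_simps)

lemma signed_adj_cong:
  "(\<And>y. length y = length x \<Longrightarrow> f y = g y) \<Longrightarrow> signed_adj f x = signed_adj g x"
  by (simp add: signed_adj_def)

lemma prod_list_bsign_nonzero: "prod_list (map bsign xs) \<noteq> 0"
  by (induction xs) (auto simp: bsign_def)

text \<open>In the square of the block form the off-diagonal blocks H - H cancel, and each diagonal
  block is H^2 + I.\<close>

lemma signed_adj_signed_adj: "signed_adj (signed_adj f) x = real (length x) * f x"
proof (induction x arbitrary: f)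
  case (Cons b x)
  show ?case
    using signed_adj_lincomb[of 1 "\<lambda>ys. f ((\<not> b) # ys)" "bsign b"
        "signed_adj (\<lambda>ys. f (b # ys))" x]
    by (simp add: signed_adj_Cons Cons.IH) (auto simp: bsign_def algebra_simps)
qed simp

lemma sum_lists_Suc:
  "(\<Sum>x | length x = Suc n. F x) =
    (\<Sum>xs | length xs = n. F (True # xs)) + (\<Sum>xs | length xs = n. (F (False # xs) :: real))"
proof -
  let ?C = "{xs :: bool list. length xs = n}"
  have fin: "finite ?C" using finite_pverts_hypercube[of n] by simp
  have "{x :: bool list. length x = Suc n} = Cons True ` ?C \<union> Cons False ` ?C"
    by (auto simp: length_Suc_conv)
  moreover have "sum F (Cons True ` ?C \<union> Cons False ` ?C)
      = sum F (Cons True ` ?C) + sum F (Cons False ` ?C)"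
    using fin by (intro sum.union_disjoint) auto
  ultimately show ?thesis by (simp add: sum.reindex)
qed

lemma signed_adj_symmetric:
  "(\<Sum>x | length x = n. f x * signed_adj g x) = (\<Sum>x | length x = n. signed_adj f x * g x)"
proof (induction n arbitrary: f g)
  case (Suc n)
  have "(\<Sum>x | length x = n. f (b # x) * signed_adj (\<lambda>ys. g (b # ys)) x) =
     (\<Sum>x | length x = n. signed_adj (\<lambda>ys. f (b # ys)) x * g (b # x))" for b
    by (rule Suc.IH)
  then show ?case
    by (simp add: sum_lists_Suc signed_adj_Cons bsign_def algebra_simps sum.distrib sum_subtractf)
qed simp

text \<open>By symmetry |A f|^2 = <f, A^2 f> = 2 sqrt d <f, A f>, so A f vanishes with the quadratic
  form.\<close>

lemma signed_adj_psd:
  fixes f :: "bool list \<Rightarrow> real"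
  defines "A \<equiv> \<lambda>x. signed_adj f x + sqrt (length x) * f x"
  assumes zero: "(\<Sum>x | length x = d. f x * A x) = 0" and x: "length x = d"
  shows "A x = 0"
proof -
  \<comment> \<open>The image of A lies in the eigenspace for \<open>sqrt d\<close>, because (H -
    sqrt d)(H + sqrt d) = H^2 - d = 0.\<close>
  have *: "signed_adj A x = sqrt d * A x" if "length x = d" for x
  proof -
    have "signed_adj A x = signed_adj (\<lambda>x. 1 * signed_adj f x + sqrt d * f x) x"
      using that by (intro signed_adj_cong) (simp add: A_def)
    also have "\<dots> = real d * f x + sqrt d * signed_adj f x"
      using signed_adj_lincomb[of 1 "signed_adj f" "sqrt d" f x] that
      by (simp add: signed_adj_signed_adj)
    also have "\<dots> = sqrt d * A x"
      using that by (simp add: A_def algebra_simps flip: mult.assoc)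
    finally show ?thesis .
  qed
  have "(\<Sum>x | length x = d. (A x)\<^sup>2) =
      (\<Sum>x | length x = d. A x * signed_adj f x) + sqrt d * (\<Sum>x | length x = d. f x * A x)"
    unfolding sum_distrib_left sum.distrib[symmetric]
    by (intro sum.cong) (auto simp: A_def power2_eq_square algebra_simps)
  also have "(\<Sum>x | length x = d. A x * signed_adj f x) = (\<Sum>x | length x = d. signed_adj A x * f x)"
    by (rule signed_adj_symmetric)
  also have "\<dots> = sqrt d * (\<Sum>x | length x = d. f x * A x)"
    unfolding sum_distrib_left by (intro sum.cong) (auto simp: *)
  finally have "(\<Sum>x | length x = d. (A x)\<^sup>2) = 0" using zero by simp
  then show ?thesis
    using x finite_pverts_hypercube[of d] by (simp add: sum_nonneg_eq_0_iff)
qed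

section \<open>Kernel vectors vanishing on a small set\<close>

text \<open>Elimination in place of a dimension count: functions supported on \<open>I\<close> stand
  for the coordinate space, and the induction on \<open>J\<close> spends one coordinate on each
  functional.\<close>

lemma ex_nonzero_in_common_kernel:
  fixes \<phi> :: "'j \<Rightarrow> ('i \<Rightarrow> real) \<Rightarrow> real"
  assumes "finite J" "card J < card I"
    and lin: "\<And>j a b y z. j \<in> J \<Longrightarrow> \<phi> j (\<lambda>i. a * y i + b * z i) = a * \<phi> j y + b * \<phi> j z"
  shows "\<exists>y. (\<forall>i. i \<notin> I \<longrightarrow> y i = 0) \<and> (\<exists>i. y i \<noteq> 0) \<and> (\<forall>j\<in>J. \<phi> j y = 0)"
  using assms
proof (induction J arbitrary: I rule: finite_induct)
  case empty
  then obtain i where "i \<in> I" by fastforce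
  then show ?case by (intro exI[of _ "\<lambda>k. if k = i then 1 else 0"]) auto
next
  case (insert j J)
  have IH: "\<exists>y. (\<forall>k. k \<notin> I - {i} \<longrightarrow> y k = 0) \<and> (\<exists>i. y i \<noteq> 0) \<and> (\<forall>j\<in>J. \<phi> j y = 0)"
    if "i \<in> I" for i
    using that insert by (intro insert.IH) auto
  from insert obtain i where "i \<in> I" by fastforce
  from IH[OF this] obtain y where y: "\<forall>k. k \<notin> I \<longrightarrow> y k = 0" "\<exists>i. y i \<noteq> 0" "\<forall>j\<in>J. \<phi> j y = 0"
    by blast
  then obtain k where k: "k \<in> I" "y k \<noteq> 0" by blast
  \<comment> \<open>Dropping the coordinate \<open>k\<close>, where \<open>y\<close> is nonzero,
    makes \<open>z\<close> independent of \<open>y\<close>; the combination \<open>?x\<close> below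
    then has the entry \<open>\<phi> j z * y k\<close> at \<open>k\<close>.\<close>
  from IH[OF this(1)] obtain z where z: "\<forall>i. i \<notin> I - {k} \<longrightarrow> z i = 0" "\<exists>i. z i \<noteq> 0"
    "\<forall>j\<in>J. \<phi> j z = 0" by blast
  show ?case
  proof (cases "\<phi> j z = 0")
    case True
    then show ?thesis using z by blast
  next
    case False
    let ?x = "\<lambda>i. \<phi> j z * y i + (- \<phi> j y) * z i"
    have "\<phi> j' ?x = \<phi> j z * \<phi> j' y + (- \<phi> j y) * \<phi> j' z" if "j' \<in> insert j J" for j'
      by (rule insert.prems(2)) (fact that)
    then have "\<forall>j'\<in>insert j J. \<phi> j' ?x = 0" using y(3) z(3) by auto
    moreover have "?x k \<noteq> 0" using k z(1) False by simp
    moreover have "\<forall>i. i \<notin> I \<longrightarrow> ?x i = 0" using y(1) z(1) by simp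
    ultimately show ?thesis by (intro exI[of _ ?x]) (intro conjI exI[of _ k])
  qed
qed

text \<open>
  The kernel of \<open>H + sqrt d\<close> is parametrised by its values on the facet of lists starting with
  \<open>False\<close>: the rows of that facet determine the values on the opposite one, and \<open>H\<^sup>2 = d\<close> shows
  that the remaining rows hold as well.
\<close>

lemma ex_signed_adj_kernel_vanishing:
  assumes B: "B \<subseteq> {x. length x = Suc n}" "card B < 2 ^ n"
  obtains f where "\<And>x. length x = Suc n \<Longrightarrow> signed_adj f x + sqrt (length x) * f x = 0"
    "\<And>x. x \<in> B \<Longrightarrow> f x = 0" "\<exists>x. length x = Suc n \<and> f x \<noteq> 0"
proof -
  let ?r = "sqrt (Suc n)"
  \<comment> \<open>The first branch solves the kernel equation at \<open>False # xs\<close> for the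
    value at \<open>True # xs\<close>.\<close>
  define E where "E y x = (if hd x then - (signed_adj y (tl x) + ?r * y (tl x)) else y (tl x))"
    for y :: "bool list \<Rightarrow> real" and x
  have lin: "E (\<lambda>i. a * y i + b * z i) x = a * E y x + b * E z x" for a b y z x
    by (simp add: E_def signed_adj_lincomb algebra_simps)
  have "finite B"
    using B(1) finite_pverts_hypercube[of "Suc n"] finite_subset by auto
  moreover have "card B < card {xs :: bool list. length xs = n}"
    using B(2) card_pverts_hypercube[of n] by simp
  ultimately obtain y where y: "\<forall>i. i \<notin> {xs. length xs = n} \<longrightarrow> y i = 0" "\<exists>i. y i \<noteq> 0"
    "\<forall>b\<in>B. E y b = 0"
    using ex_nonzero_in_common_kernel[of B "{xs. length xs = n}" "\<lambda>b y. E y b"] lin by auto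
  have "signed_adj (E y) x + sqrt (length x) * E y x = 0" if len: "length x = Suc n" for x
  proof -
    obtain b xs where x: "x = b # xs" and xs: "length xs = n"
      using len by (cases x) auto
    have EF: "(\<lambda>ys. E y (False # ys)) = y"
      and ET: "(\<lambda>ys. E y (True # ys)) = (\<lambda>ys. (- 1) * signed_adj y ys + (- ?r) * y ys)"
      by (simp_all add: E_def)
    have "signed_adj (\<lambda>ys. E y (True # ys)) xs = - (real n * y xs + ?r * signed_adj y xs)"
      unfolding ET signed_adj_lincomb signed_adj_signed_adj using xs by simp
    \<comment> \<open>The equation at \<open>True # xs\<close> reduces to (1 + n) y -
      \<open>?r\<close>^2 y = 0, which explains the root of \<open>Suc n\<close> rather than of
      \<open>n\<close>.\<close>
    moreover have "?r * (?r * y xs) = (1 + real n) * y xs"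
      by (simp flip: mult.assoc)
    ultimately show ?thesis
      using xs x EF by (cases b) (simp_all add: signed_adj_Cons bsign_def E_def algebra_simps)
  qed
  moreover obtain xs where "length xs = n" "y xs \<noteq> 0" using y(1,2) by blast
  then have "\<exists>x. length x = Suc n \<and> E y x \<noteq> 0"
    by (intro exI[of _ "False # xs"]) (simp add: E_def)
  ultimately show thesis using that[of "E y"] y(3) by blast
qed

section \<open>Forcing preserves the zeros of kernel vectors; the lower bound\<close>

lemma psd_can_force_preserves_zero:
  assumes ker: "\<And>x. length x = d \<Longrightarrow> signed_adj f x + sqrt (length x) * f x = 0"
    and B: "B \<subseteq> {x. length x = d}" "\<And>x. x \<in> B \<Longrightarrow> f x = 0"
    and force: "psd_can_force (with_proj (hypercube d)) B u w"
  shows "f w = 0"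
proof -
  interpret sym_digraph "with_proj (hypercube d)" by (rule sym_digraph_hypercube)
  obtain W where u: "u \<in> B" and W: "W \<subseteq> {x. length x = d} - B" and w: "w \<in> W"
    and uw: "(u, w) \<in> parcs (hypercube d)"
    and only: "\<And>v. v \<in> W \<Longrightarrow> (u, v) \<in> parcs (hypercube d) \<Longrightarrow> v = w"
    and closed: "\<And>x y. x \<in> W \<Longrightarrow> (x, y) \<in> parcs (hypercube d) \<Longrightarrow> y \<notin> B \<Longrightarrow> y \<in> W"
    by (rule psd_can_forceE[OF force, unfolded with_proj_simps pverts_hypercube]) (rule that)
  define g where "g x = (if x \<in> W then f x else 0)" for x
  \<comment> \<open>Neighbours of \<open>W\<close> lie in \<open>W\<close> or in \<open>B\<close>,
    where \<open>f\<close> vanishes, so cutting \<open>f\<close> down to \<open>W\<close> leaves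
    these rows unchanged.\<close>
  have "signed_adj g x = signed_adj f x" if "x \<in> W" for x
    unfolding signed_adj_def
  proof (intro sum.cong refl)
    fix i assume "i \<in> {..<length x}"
    then have "(x, flip i x) \<in> parcs (hypercube d)"
      using that W by (auto simp: parcs_hypercube_iff)
    then have "g (flip i x) = f (flip i x)"
      using closed[OF that] B(2) by (auto simp: g_def)
    then show "prod_list (map bsign (take i x)) * g (flip i x) =
        prod_list (map bsign (take i x)) * f (flip i x)" by simp
  qed
  \<comment> \<open>The quadratic form vanishes term by term: outside \<open>W\<close> through
    \<open>g x\<close>, inside through the kernel equation of \<open>f\<close>.\<close>
  then have zero: "g x * (signed_adj g x + sqrt (length x) * g x) = 0" for x
    using ker[of x] W by (auto simp: g_def)
  have "signed_adj g u + sqrt (length u) * g u = 0"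
    using u B(1) by (intro signed_adj_psd[of _ d] sum.neutral ballI zero) auto
  moreover have "g u = 0" using u W by (auto simp: g_def)
  ultimately have "signed_adj g u = 0" by simp
  moreover obtain i where i: "i < d" "w = flip i u" and len: "length u = d"
    using uw by (auto simp: parcs_hypercube_iff)
  \<comment> \<open>Only the neighbour \<open>w\<close> of \<open>u\<close> lies in
    \<open>W\<close>, so a single term with nonzero sign survives.\<close>
  have "signed_adj g u = (\<Sum>j\<in>{i}. prod_list (map bsign (take j u)) * g (flip j u))"
    unfolding signed_adj_def
  proof (intro sum.mono_neutral_right ballI)
    fix j assume j: "j \<in> {..<length u} - {i}"
    then have "flip j u \<noteq> w"
      using i len inj_on_flip[of u] by (auto dest: inj_onD)
    then have "flip j u \<notin> W"
      using only[of "flip j u"] j len by (auto simp: parcs_hypercube_iff)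
    then show "prod_list (map bsign (take j u)) * g (flip j u) = 0" by (simp add: g_def)
  qed (use i len in auto)
  ultimately show ?thesis
    using i w prod_list_bsign_nonzero by (simp add: g_def)
qed

lemma leaky_psd_forcing_set_card_ge:
  assumes "1 \<le> d" "l \<le> 2 ^ d" and forcing: "leaky_psd_forcing_set l (with_proj (hypercube d)) B"
  shows "2 ^ (d - 1) \<le> card B"
proof (rule ccontr)
  assume "\<not> 2 ^ (d - 1) \<le> card B"
  moreover obtain n where d: "d = Suc n" using assms(1) by (cases d) auto
  moreover have B: "B \<subseteq> {x. length x = d}"
    using forcing unfolding leaky_psd_forcing_set_def by simp
  ultimately obtain f where f: "\<And>x. length x = d \<Longrightarrow> signed_adj f x + sqrt (length x) * f x = 0"
    "\<And>x. x \<in> B \<Longrightarrow> f x = 0" "\<exists>x. length x = d \<and> f x \<noteq> 0"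
    using ex_signed_adj_kernel_vanishing[of B n] by auto
  \<comment> \<open>Any \<open>l\<close> leaks serve here, since a force preserves the zeros of
    \<open>f\<close> no matter which vertex performs it.\<close>
  obtain L where L: "L \<subseteq> pverts (hypercube d)" "card L = l"
    using obtain_subset_with_card_n[of l "pverts (hypercube d)"] assms(2)
      card_pverts_hypercube[of d] by auto
  then have "(psd_step (with_proj (hypercube d)) L)\<^sup>*\<^sup>* B {x. length x = d}"
    using forcing unfolding leaky_psd_forcing_set_def by auto
  moreover have "C \<subseteq> {x. length x = d} \<and> (\<forall>x\<in>C. f x = 0)"
    if "(psd_step (with_proj (hypercube d)) L)\<^sup>*\<^sup>* B C" for C
    using that
  proof induction
    case base
    then show ?case using B f(2) by blast
  next
    case (step C D)
    then obtain u w where uw: "psd_can_force (with_proj (hypercube d)) C u w" "D = insert w C"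
      unfolding psd_step_def by blast
    interpret sym_digraph "with_proj (hypercube d)" by (rule sym_digraph_hypercube)
    have "length w = d" using psd_can_force_dominates[OF uw(1)] by (auto simp: parcs_hypercube_iff)
    then show ?case
      using step.IH uw f(1) psd_can_force_preserves_zero[of d f C u w] by blast
  qed
  ultimately show False using f(3) by blast
qed

theorem theorem31:
  fixes d l :: nat
  assumes "1 \<le> d" and "l \<le> 2 ^ d"
  shows "leaky_psd_forcing_number l (with_proj (hypercube d)) =
    (if l \<le> d - 1 then 2 ^ (d - 1) else 2 ^ d)"
proof (cases "l \<le> d - 1")
  case True
  then have "leaky_psd_forcing_number l (with_proj (hypercube d)) = 2 ^ (d - 1)"
    using assms card_even_lists[of "d - 1"]
    by (intro leaky_psd_forcing_number_eqI[OF leaky_psd_forcing_set_even]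
        leaky_psd_forcing_set_card_ge) auto
  then show ?thesis using True by simp
next
  case False
  then have "leaky_psd_forcing_number l (with_proj (hypercube d)) = 2 ^ d"
    using assms card_pverts_hypercube[of d] leaky_psd_forcing_set_many_leaks[of d l]
    by (intro leaky_psd_forcing_number_eqI[OF leaky_psd_forcing_set_verts]) auto
  then show ?thesis using False by simp
qed

end
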